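(* Let $(X,d_X,\leq_{P_1})$ and $(Y,d_Y,\leq_{P_2})$ be two partially ordered complete metric spaces. Let $F:X\times Y\rightarrow X$ and $G:Y\times X\rightarrow Y$ be two continuous functions having the mixed monotone property. Assume that there exist $k,l \in \left[0,\frac{1}{2}\right)$ such that $$d_X(F(x,y),F(u,v))\leq k\, M(x,y,u,v)\quad \text{for all } x,u\in X,\ y,v\in Y \text{ with } x\geq_{P_1}u,\ y\leq_{P_2}v,$$ $$d_Y(G(y,x),G(v,u))\leq l\, N(y,x,v,u)\quad \text{for all } x,u\in X,\ y,v\in Y \text{ with } x\leq_{P_1}u,\ y\geq_{P_2}v,$$ where $$M(x,y,u,v)= \max \{d_X(x,u),\,d_X(x,F(x,y)),\,d_X(x,F(u,v)),\,d_X(u,F(u,v)),\,d_X(u,F(x,y))\},$$ $$N(y,x,v,u)= \max \{ d_Y(y,v),\, d_Y(y,G(y,x)),\, d_Y(y,G(v,u)),\, d_Y(v,G(v,u)),\, d_Y(v,G(y,x)) \}.$$ If there exist $x_0\in X$, $y_0\in Y$ satisfying $x_0\leq_{P_1} F(x_0, y_0)$ and $y_0\geq_{P_2} G(y_0, x_0)$, then there exist $x\in X$, $y\in Y$ such that $x=F(x,y)$ and $y=G(y,x)$.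
   Context: A partially ordered complete metric space $(X,d_X,\leq_{P_1})$ is a set $X$ with a metric $d_X$ for which it is complete and a partial order $\leq_{P_1}$ (no compatibility between them is assumed). The product $X\times Y$ carries the metric $d((x,y),(u,v))=d_X(x,u)+d_Y(y,v)$ (similarly for $Y\times X$). The maps $F:X\times Y\to X$ and $G:Y\times X\to Y$ have the mixed monotone property if for all $x\in X$, $y\in Y$: for all $x_1,x_2\in X$, $x_1\leq_{P_1} x_2$ implies $F(x_1,y)\leq_{P_1} F(x_2,y)$ and $G(y,x_1)\geq_{P_2}G(y,x_2)$; and for all $y_1,y_2\in Y$, $y_1\leq_{P_2}y_2$ implies $F(x,y_1)\geq_{P_1}F(x,y_2)$ and $G(y_1,x)\leq_{P_2}G(y_2,x)$. *)

theory Defs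
  imports "HOL-Analysis.Abstract_Metric_Spaces"
begin

locale partially_ordered_complete_metric_space = Metric_space M d
  for M :: "'a set" and d :: "'a \<Rightarrow> 'a \<Rightarrow> real" +
  fixes le :: "'a \<Rightarrow> 'a \<Rightarrow> bool"
  assumes complete: "mcomplete"
    and refl: "reflp_on M le"
    and antisym: "antisymp_on M le"
    and trans: "transp_on M le"

(* The library's product metric (prod_dist) is the Euclidean one. *)
definition sum_dist ::
    "('a \<Rightarrow> 'a \<Rightarrow> real) \<Rightarrow> ('b \<Rightarrow> 'b \<Rightarrow> real) \<Rightarrow> 'a \<times> 'b \<Rightarrow> 'a \<times> 'b \<Rightarrow> real" where
  "sum_dist d1 d2 = (\<lambda>(x, y) (u, v). d1 x u + d2 y v)"

(* Makes Metric_space.mtopology (X \<times> Y) (sum_dist dX dY) meaningful. *)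
lemma Metric_space_sum_dist:
  assumes "Metric_space X dX" and "Metric_space Y dY"
  shows "Metric_space (X \<times> Y) (sum_dist dX dY)"
proof -
  interpret X: Metric_space X dX by fact
  interpret Y: Metric_space Y dY by fact
  show ?thesis
  proof
    show "0 \<le> sum_dist dX dY p q" for p q
      by (simp add: sum_dist_def split_beta)
    show "sum_dist dX dY p q = sum_dist dX dY q p" for p q
      by (simp add: sum_dist_def split_beta X.commute Y.commute)
    show "sum_dist dX dY p q = 0 \<longleftrightarrow> p = q" if "p \<in> X \<times> Y" "q \<in> X \<times> Y" for p q
      using that by (auto simp: sum_dist_def add_nonneg_eq_0_iff)
    show "sum_dist dX dY p r \<le> sum_dist dX dY p q + sum_dist dX dY q r"
      if "p \<in> X \<times> Y" "q \<in> X \<times> Y" "r \<in> X \<times> Y" for p q r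
      using that X.triangle[of "fst p" "fst q" "fst r"] Y.triangle[of "snd p" "snd q" "snd r"]
      by (auto simp: sum_dist_def split_beta)
  qed
qed

definition mixed_monotone ::
    "'a set \<Rightarrow> ('a \<Rightarrow> 'a \<Rightarrow> bool) \<Rightarrow> 'b set \<Rightarrow> ('b \<Rightarrow> 'b \<Rightarrow> bool)
      \<Rightarrow> ('a \<times> 'b \<Rightarrow> 'a) \<Rightarrow> ('b \<times> 'a \<Rightarrow> 'b) \<Rightarrow> bool" where
  "mixed_monotone X leX Y leY F G \<longleftrightarrow>
    (\<forall>x\<in>X. \<forall>y\<in>Y.
      (\<forall>x1\<in>X. \<forall>x2\<in>X. leX x1 x2 \<longrightarrow>
         leX (F (x1, y)) (F (x2, y)) \<and> leY (G (y, x2)) (G (y, x1))) \<and>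
      (\<forall>y1\<in>Y. \<forall>y2\<in>Y. leY y1 y2 \<longrightarrow>
         leX (F (x, y2)) (F (x, y1)) \<and> leY (G (y1, x)) (G (y2, x))))"

end

theory Submission imports Defs begin

text \<open>
  Iterate \<open>(x, y) \<mapsto> (F (x, y), G (y, x))\<close> from \<open>(x0, y0)\<close>. Mixed monotonicity makes the \<open>x\<close>-orbit
  increasing and the \<open>y\<close>-orbit decreasing, so the contractive conditions apply to consecutive
  iterates. There the maximum involves only three consecutive points of one orbit and is at most the
  sum of the two consecutive distances \<open>a\<^sub>n + a\<^sub>n\<^sub>+\<^sub>1\<close>, whence \<open>a\<^sub>n\<^sub>+\<^sub>1 \<le> k / (1 - k) * a\<^sub>n\<close> with
  \<open>k / (1 - k) < 1\<close>. Both orbits thus converge, and continuity identifies the limits.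
\<close>

text \<open>The triangle inequality, iterated, bounds \<open>d (s m) (s n)\<close> by a block of the
  series of consecutive distances, and such blocks are eventually small for a summable
  series.\<close>

lemma (in Metric_space) MCauchy_summable_dist:
  assumes M: "range s \<subseteq> M" and sum: "summable (\<lambda>n. d (s n) (s (Suc n)))"
  shows "MCauchy s"
proof -
  have le: "d (s m) (s n) \<le> (\<Sum>i=m..<n. d (s i) (s (Suc i)))" if "m \<le> n" for m n
    using that
  proof (induction n rule: dec_induct)
    case base
    then show ?case using M by (simp add: range_subsetD)
  next
    case (step n)
    have "d (s m) (s (Suc n)) \<le> d (s m) (s n) + d (s n) (s (Suc n))"
      using M by (intro triangle) auto
    with step show ?case by simp
  qed
  have "\<exists>N. \<forall>m n. N \<le> m \<longrightarrow> N \<le> n \<longrightarrow> d (s m) (s n) < e" if "e > 0" for e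
  proof -
    obtain N where N: "\<And>m n. m \<ge> N \<Longrightarrow> norm (\<Sum>i=m..<n. d (s i) (s (Suc i))) < e"
      using sum \<open>e > 0\<close> unfolding summable_Cauchy by blast
    have *: "d (s m) (s n) < e" if "N \<le> m" "m \<le> n" for m n
      using le[OF \<open>m \<le> n\<close>] N[OF \<open>N \<le> m\<close>, of n] by simp
    have "d (s m) (s n) < e" if "N \<le> m" "N \<le> n" for m n
      using *[of m n] *[of n m] that commute by (cases "m \<le> n") auto
    then show ?thesis by blast
  qed
  with M show ?thesis by (simp add: MCauchy_def)
qed

text \<open>Isolates the metric content of the contractive conditions along an orbit, free of the
  order, so that it serves both spaces. The entry 0 is the distance from \<open>s (Suc n)\<close> to
  itself, which occurs when the maximum is evaluated at consecutive iterates.\<close>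

lemma (in Metric_space) MCauchy_quasi_contraction:
  assumes M: "range s \<subseteq> M" and k: "0 \<le> k" "k < 1 / 2"
    and step: "\<And>n. d (s (Suc n)) (s (Suc (Suc n)))
      \<le> k * Max {d (s n) (s (Suc n)), d (s (Suc n)) (s (Suc (Suc n))), d (s n) (s (Suc (Suc n))), 0}"
  shows "MCauchy s"
proof (rule MCauchy_summable_dist[OF M])
  define a where "a n = d (s n) (s (Suc n))" for n
  have ratio: "a (Suc n) \<le> k / (1 - k) * a n" for n
  proof -
    have "d (s n) (s (Suc (Suc n))) \<le> a n + a (Suc n)"
      unfolding a_def using M by (intro triangle) auto
    then have "Max {a n, a (Suc n), d (s n) (s (Suc (Suc n))), 0} \<le> a n + a (Suc n)"
      by (simp add: a_def)
    then have "a (Suc n) \<le> k * (a n + a (Suc n))"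
      using step[of n] k mult_left_mono unfolding a_def by (meson order_trans)
    \<comment> \<open>Absorb \<open>k * a (Suc n)\<close> on the left and divide by
      \<open>1 - k > 0\<close>.\<close>
    then show ?thesis using k by (simp add: field_simps)
  qed
  have "summable a"
  proof (rule summable_ratio_test)
    \<comment> \<open>This is where the bound 1/2 enters: the ratio is below 1 because
      \<open>k < 1 - k\<close>.\<close>
    show "k / (1 - k) < 1" using k by (simp add: field_simps)
    show "norm (a (Suc n)) \<le> k / (1 - k) * norm (a n)" for n
      using ratio[of n] by (simp add: a_def)
  qed
  then show "summable (\<lambda>n. d (s n) (s (Suc n)))" by (simp add: a_def[abs_def])
qed

lemma limitin_sum_dist:
  assumes "Metric_space X dX" and "Metric_space Y dY"
    and s: "limitin (Metric_space.mtopology X dX) s x G"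
    and t: "limitin (Metric_space.mtopology Y dY) t y G"
  shows "limitin (Metric_space.mtopology (X \<times> Y) (sum_dist dX dY)) (\<lambda>n. (s n, t n)) (x, y) G"
proof -
  interpret X: Metric_space X dX by fact
  interpret Y: Metric_space Y dY by fact
  interpret XY: Metric_space "X \<times> Y" "sum_dist dX dY"
    by (intro Metric_space_sum_dist assms)
  have "((\<lambda>n. dX (s n) x + dY (t n) y) \<longlongrightarrow> 0 + 0) G"
    using s t unfolding X.limitin_metric_dist_null Y.limitin_metric_dist_null
    by (intro tendsto_add) auto
  with s t show ?thesis
    unfolding X.limitin_metric_dist_null Y.limitin_metric_dist_null XY.limitin_metric_dist_null
    by (auto simp: sum_dist_def eventually_conj_iff)
qed

text \<open>The sequence \<open>F (s n, t n)\<close> tends to \<open>F (x, y)\<close> by continuity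
  and to \<open>x\<close> as a shift of \<open>s\<close>; limits in a metric space are unique. Only
  one recursion is assumed, so the lemma also applies to \<open>G\<close> with the two spaces
  exchanged.\<close>

lemma continuous_map_iterates_fixpoint:
  assumes "Metric_space X dX" and "Metric_space Y dY"
    and F: "continuous_map (Metric_space.mtopology (X \<times> Y) (sum_dist dX dY))
      (Metric_space.mtopology X dX) F"
    and s: "limitin (Metric_space.mtopology X dX) s x sequentially"
    and t: "limitin (Metric_space.mtopology Y dY) t y sequentially"
    and rec: "\<And>n. s (Suc n) = F (s n, t n)"
  shows "x = F (x, y)"
proof -
  interpret X: Metric_space X dX by fact
  have "limitin X.mtopology (F \<circ> (\<lambda>n. (s n, t n))) (F (x, y)) sequentially"
    by (intro continuous_map_limit[OF F] limitin_sum_dist assms)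
  moreover have "limitin X.mtopology (F \<circ> (\<lambda>n. (s n, t n))) x sequentially"
    using limitin_sequentially_offset[OF s, of 1] by (simp add: rec o_def)
  ultimately show ?thesis
    using X.limitin_metric_unique trivial_limit_sequentially by blast
qed

theorem theorem3p1:
  fixes X :: "'a set" and dX :: "'a \<Rightarrow> 'a \<Rightarrow> real" and leX :: "'a \<Rightarrow> 'a \<Rightarrow> bool"
    and Y :: "'b set" and dY :: "'b \<Rightarrow> 'b \<Rightarrow> real" and leY :: "'b \<Rightarrow> 'b \<Rightarrow> bool"
    and F :: "'a \<times> 'b \<Rightarrow> 'a" and G :: "'b \<times> 'a \<Rightarrow> 'b"
    and k l :: real and x0 :: 'a and y0 :: 'b
  assumes "partially_ordered_complete_metric_space X dX leX"
    and "partially_ordered_complete_metric_space Y dY leY"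
    and "F \<in> X \<times> Y \<rightarrow> X" and "G \<in> Y \<times> X \<rightarrow> Y"
    and "continuous_map (Metric_space.mtopology (X \<times> Y) (sum_dist dX dY))
           (Metric_space.mtopology X dX) F"
    and "continuous_map (Metric_space.mtopology (Y \<times> X) (sum_dist dY dX))
           (Metric_space.mtopology Y dY) G"
    and "mixed_monotone X leX Y leY F G"
    and "0 \<le> k" and "k < 1 / 2" and "0 \<le> l" and "l < 1 / 2"
    and "\<And>x u y v. \<lbrakk>x \<in> X; u \<in> X; y \<in> Y; v \<in> Y; leX u x; leY y v\<rbrakk> \<Longrightarrow>
           dX (F (x, y)) (F (u, v)) \<le>
             k * Max {dX x u, dX x (F (x, y)), dX x (F (u, v)), dX u (F (u, v)), dX u (F (x, y))}"
    and "\<And>x u y v. \<lbrakk>x \<in> X; u \<in> X; y \<in> Y; v \<in> Y; leX x u; leY v y\<rbrakk> \<Longrightarrow>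
           dY (G (y, x)) (G (v, u)) \<le>
             l * Max {dY y v, dY y (G (y, x)), dY y (G (v, u)), dY v (G (v, u)), dY v (G (y, x))}"
    and "x0 \<in> X" and "y0 \<in> Y"
    and "leX x0 (F (x0, y0))" and "leY (G (y0, x0)) y0"
  shows "\<exists>x\<in>X. \<exists>y\<in>Y. x = F (x, y) \<and> y = G (y, x)"
proof -
  note X = assms(1) and Y = assms(2) and F = assms(3) and G = assms(4)
    and contF = assms(5) and contG = assms(6) and mono = assms(7)
    and k = assms(8,9) and l = assms(10,11) and contrF = assms(12) and contrG = assms(13)
    and init = assms(14-17)
  interpret X: partially_ordered_complete_metric_space X dX leX by fact
  interpret Y: partially_ordered_complete_metric_space Y dY leY by fact
  define p where "p n = ((\<lambda>(x, y). (F (x, y), G (y, x))) ^^ n) (x0, y0)" for n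
  define s t where "s n = fst (p n)" and "t n = snd (p n)" for n
  have s_Suc: "s (Suc n) = F (s n, t n)" and t_Suc: "t (Suc n) = G (t n, s n)" for n
    by (simp_all add: s_def t_def p_def split_beta)
  have in_XY: "s n \<in> X \<and> t n \<in> Y" for n
  proof (induction n)
    case 0
    then show ?case using init by (simp add: s_def t_def p_def)
  next
    case (Suc n)
    then show ?case using F G by (auto simp: s_Suc t_Suc)
  qed
  then have sX: "s n \<in> X" and tY: "t n \<in> Y" for n by auto
  have "leX (s n) (s (Suc n)) \<and> leY (t (Suc n)) (t n)" for n
  proof (induction n)
    case 0
    show ?case using init by (simp add: s_def t_def p_def)
  next
    case (Suc n)
    \<comment> \<open>Mixed monotonicity controls one argument at a time, so each comparison passes
      through a mixed point that combines indices \<open>n\<close> and \<open>Suc n\<close>.\<close>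
    have "leX (F (s n, t n)) (F (s (Suc n), t n))"
      "leX (F (s (Suc n), t n)) (F (s (Suc n), t (Suc n)))"
      "leY (G (t (Suc n), s (Suc n))) (G (t n, s (Suc n)))"
      "leY (G (t n, s (Suc n))) (G (t n, s n))"
      using mono Suc sX tY unfolding mixed_monotone_def by blast+
    \<comment> \<open>Transitivity holds only on the carriers, and the mixed points need not lie on
      the orbits; hence independent indices \<open>i\<close> and \<open>j\<close>.\<close>
    moreover have "F (s i, t j) \<in> X" "G (t i, s j) \<in> Y" for i j
      using F G sX tY by blast+
    ultimately show ?case
      unfolding s_Suc[of "Suc n"] t_Suc[of "Suc n"] s_Suc[of n] t_Suc[of n]
      using transp_onD[OF X.trans] transp_onD[OF Y.trans] by (metis s_Suc t_Suc)
  qed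
  then have s_le: "leX (s n) (s (Suc n))" and t_le: "leY (t (Suc n)) (t n)" for n by auto
  have "X.MCauchy s"
  proof (rule X.MCauchy_quasi_contraction)
    show "dX (s (Suc n)) (s (Suc (Suc n))) \<le> k * Max {dX (s n) (s (Suc n)),
        dX (s (Suc n)) (s (Suc (Suc n))), dX (s n) (s (Suc (Suc n))), 0}" for n
      \<comment> \<open>The order conditions force the later iterate into the first position here,
        so symmetry of \<open>dX\<close> is needed; for \<open>G\<close> below the earlier iterate
        comes first.\<close>
      using contrF[OF sX sX tY tY s_le t_le, of n n] sX
      by (simp add: s_Suc[symmetric] X.commute insert_commute)
  qed (use sX k in auto)
  then obtain x where x: "limitin X.mtopology s x sequentially"
    using X.complete X.mcomplete_def by blast
  have "Y.MCauchy t"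
  proof (rule Y.MCauchy_quasi_contraction)
    show "dY (t (Suc n)) (t (Suc (Suc n))) \<le> l * Max {dY (t n) (t (Suc n)),
        dY (t (Suc n)) (t (Suc (Suc n))), dY (t n) (t (Suc (Suc n))), 0}" for n
      using contrG[OF sX sX tY tY s_le t_le, of n n] tY
      by (simp add: t_Suc[symmetric] insert_commute)
  qed (use tY l in auto)
  then obtain y where y: "limitin Y.mtopology t y sequentially"
    using Y.complete Y.mcomplete_def by blast
  have "x = F (x, y)"
    using continuous_map_iterates_fixpoint[OF _ _ contF x y s_Suc]
      X.Metric_space_axioms Y.Metric_space_axioms by blast
  moreover have "y = G (y, x)"
    using continuous_map_iterates_fixpoint[OF _ _ contG y x t_Suc]
      X.Metric_space_axioms Y.Metric_space_axioms by blast
  moreover have "x \<in> X" "y \<in> Y"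
    using x y by (auto dest: limitin_topspace)
  ultimately show ?thesis by blast
qed

end
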